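(* Let $\mathbf D$ and $\mathbf M$ be fully contextual double Boolean algebras. Then $\mathbf D$ is isomorphic to $\mathbf M$ if and only if $\mathbf D_p$ is isomorphic to $\mathbf M_p$. Moreover, every dBa isomorphism from $\mathbf D_p$ to $\mathbf M_p$ extends uniquely to a dBa isomorphism from $\mathbf D$ to $\mathbf M$.
   Context: A double Boolean algebra (dBa) is an algebra $\mathbf{D}=(D,\sqcup,\sqcap,\neg,\lrcorner,\top,\bot)$ of type $(2,2,1,1,0,0)$ such that, with $x\vee y:=\neg(\neg x\sqcap\neg y)$ and $x\wedge y:=\lrcorner(\lrcorner x\sqcup\lrcorner y)$, for all $x,y,z\in D$: $(x\sqcap x)\sqcap y=x\sqcap y$; $x\sqcap y=y\sqcap x$; $x\sqcap(y\sqcap z)=(x\sqcap y)\sqcap z$; $\neg(x\sqcap x)=\neg x$; $x\sqcap(x\sqcup y)=x\sqcap x$; $x\sqcap(y\vee z)=(x\sqcap y)\vee(x\sqcap z)$; $x\sqcap(x\vee y)=x\sqcap x$; $\neg\neg(x\sqcap y)=x\sqcap y$; $x\sqcap\neg x=\bot$; $\neg\bot=\top\sqcap\top$; $\neg\top=\bot$; the duals $(x\sqcup x)\sqcup y=x\sqcup y$; $x\sqcup y=y\sqcup x$; $x\sqcup(y\sqcup z)=(x\sqcup y)\sqcup z$; $\lrcorner(x\sqcup x)=\lrcorner x$; $x\sqcup(x\sqcap y)=x\sqcup x$; $x\sqcup(y\wedge z)=(x\sqcup y)\wedge(x\sqcup z)$; $x\sqcup(x\wedge y)=x\sqcup x$;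 $\lrcorner\lrcorner(x\sqcup y)=x\sqcup y$; $x\sqcup\lrcorner x=\top$; $\lrcorner\top=\bot\sqcup\bot$; $\lrcorner\bot=\top$; and $(x\sqcap x)\sqcup(x\sqcap x)=(x\sqcup x)\sqcap(x\sqcup x)$. The quasi-order is $x\sqsubseteq y$ iff $x\sqcap y=x\sqcap x$ and $x\sqcup y=y\sqcup y$. $x_\sqcap:=x\sqcap x$, $x_\sqcup:=x\sqcup x$, $D_\sqcap:=\{x:x_\sqcap=x\}$, $D_\sqcup:=\{x:x_\sqcup=x\}$, $D_p:=D_\sqcap\cup D_\sqcup$; $\mathbf D_p$ is the subalgebra of $\mathbf D$ with universe $D_p$ (it is closed under all operations). $\mathbf D$ is fully contextual if $\sqsubseteq$ is a partial order and for all $y\in D_\sqcap$, $x\in D_\sqcup$ with $y_\sqcup=x_\sqcap$ there is a unique $z\in D$ with $z_\sqcap=y$, $z_\sqcup=x$. A dBa isomorphism is a bijection preserving $\sqcup,\sqcap,\neg,\lrcorner,\top,\bot$. *)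

theory Defs
  imports "HOL-Algebra.Congruence"
begin

record 'a dba = "'a partial_object" +
  dba_join :: "'a \<Rightarrow> 'a \<Rightarrow> 'a"  (infixl \<open>\<squnion>\<index>\<close> 65)
  dba_meet :: "'a \<Rightarrow> 'a \<Rightarrow> 'a"  (infixl \<open>\<sqinter>\<index>\<close> 70)
  dba_neg :: "'a \<Rightarrow> 'a"  (\<open>\<sim>\<index>_\<close> [81] 80)
  dba_opp :: "'a \<Rightarrow> 'a"  (\<open>\<lrcorner>\<index>_\<close> [81] 80)
  dba_top :: 'a  (\<open>\<top>\<index>\<close>)
  dba_bot :: 'a  (\<open>\<bottom>\<index>\<close>)

definition dba_vee :: "('a, 'm) dba_scheme \<Rightarrow> 'a \<Rightarrow> 'a \<Rightarrow> 'a"  (infixl \<open>\<curlyvee>\<index>\<close> 65)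
  where "x \<curlyvee>\<^bsub>D\<^esub> y = \<sim>\<^bsub>D\<^esub> (\<sim>\<^bsub>D\<^esub> x \<sqinter>\<^bsub>D\<^esub> \<sim>\<^bsub>D\<^esub> y)"

definition dba_wedge :: "('a, 'm) dba_scheme \<Rightarrow> 'a \<Rightarrow> 'a \<Rightarrow> 'a"  (infixl \<open>\<curlywedge>\<index>\<close> 70)
  where "x \<curlywedge>\<^bsub>D\<^esub> y = \<lrcorner>\<^bsub>D\<^esub> (\<lrcorner>\<^bsub>D\<^esub> x \<squnion>\<^bsub>D\<^esub> \<lrcorner>\<^bsub>D\<^esub> y)"

definition dba_le :: "('a, 'm) dba_scheme \<Rightarrow> 'a \<Rightarrow> 'a \<Rightarrow> bool"  (infix \<open>\<sqsubseteq>\<index>\<close> 50)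
  where "x \<sqsubseteq>\<^bsub>D\<^esub> y \<longleftrightarrow>
    x \<sqinter>\<^bsub>D\<^esub> y = x \<sqinter>\<^bsub>D\<^esub> x \<and> x \<squnion>\<^bsub>D\<^esub> y = y \<squnion>\<^bsub>D\<^esub> y"

locale double_boolean_algebra =
  fixes D (structure)
  assumes join_closed: "\<lbrakk>x \<in> carrier D; y \<in> carrier D\<rbrakk> \<Longrightarrow> x \<squnion> y \<in> carrier D"
    and meet_closed: "\<lbrakk>x \<in> carrier D; y \<in> carrier D\<rbrakk> \<Longrightarrow> x \<sqinter> y \<in> carrier D"
    and neg_closed: "x \<in> carrier D \<Longrightarrow> \<sim> x \<in> carrier D"
    and opp_closed: "x \<in> carrier D \<Longrightarrow> \<lrcorner> x \<in> carrier D"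
    and top_closed: "\<top> \<in> carrier D"
    and bot_closed: "\<bottom> \<in> carrier D"
    and meet_idem_left: "\<lbrakk>x \<in> carrier D; y \<in> carrier D\<rbrakk> \<Longrightarrow> (x \<sqinter> x) \<sqinter> y = x \<sqinter> y"
    and meet_comm: "\<lbrakk>x \<in> carrier D; y \<in> carrier D\<rbrakk> \<Longrightarrow> x \<sqinter> y = y \<sqinter> x"
    and meet_assoc: "\<lbrakk>x \<in> carrier D; y \<in> carrier D; z \<in> carrier D\<rbrakk> \<Longrightarrow>
          x \<sqinter> (y \<sqinter> z) = (x \<sqinter> y) \<sqinter> z"
    and neg_meet_self: "x \<in> carrier D \<Longrightarrow> \<sim> (x \<sqinter> x) = \<sim> x"
    and meet_join_absorb: "\<lbrakk>x \<in> carrier D; y \<in> carrier D\<rbrakk> \<Longrightarrow> x \<sqinter> (x \<squnion> y) = x \<sqinter> x"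
    and meet_vee_distrib: "\<lbrakk>x \<in> carrier D; y \<in> carrier D; z \<in> carrier D\<rbrakk> \<Longrightarrow>
          x \<sqinter> (y \<curlyvee> z) = (x \<sqinter> y) \<curlyvee> (x \<sqinter> z)"
    and meet_vee_absorb: "\<lbrakk>x \<in> carrier D; y \<in> carrier D\<rbrakk> \<Longrightarrow> x \<sqinter> (x \<curlyvee> y) = x \<sqinter> x"
    and neg_neg_meet: "\<lbrakk>x \<in> carrier D; y \<in> carrier D\<rbrakk> \<Longrightarrow> \<sim> (\<sim> (x \<sqinter> y)) = x \<sqinter> y"
    and meet_neg: "x \<in> carrier D \<Longrightarrow> x \<sqinter> \<sim> x = \<bottom>"
    and neg_bot: "\<sim> \<bottom> = \<top> \<sqinter> \<top>"
    and neg_top: "\<sim> \<top> = \<bottom>"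
    and join_idem_left: "\<lbrakk>x \<in> carrier D; y \<in> carrier D\<rbrakk> \<Longrightarrow> (x \<squnion> x) \<squnion> y = x \<squnion> y"
    and join_comm: "\<lbrakk>x \<in> carrier D; y \<in> carrier D\<rbrakk> \<Longrightarrow> x \<squnion> y = y \<squnion> x"
    and join_assoc: "\<lbrakk>x \<in> carrier D; y \<in> carrier D; z \<in> carrier D\<rbrakk> \<Longrightarrow>
          x \<squnion> (y \<squnion> z) = (x \<squnion> y) \<squnion> z"
    and opp_join_self: "x \<in> carrier D \<Longrightarrow> \<lrcorner> (x \<squnion> x) = \<lrcorner> x"
    and join_meet_absorb: "\<lbrakk>x \<in> carrier D; y \<in> carrier D\<rbrakk> \<Longrightarrow> x \<squnion> (x \<sqinter> y) = x \<squnion> x"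
    and join_wedge_distrib: "\<lbrakk>x \<in> carrier D; y \<in> carrier D; z \<in> carrier D\<rbrakk> \<Longrightarrow>
          x \<squnion> (y \<curlywedge> z) = (x \<squnion> y) \<curlywedge> (x \<squnion> z)"
    and join_wedge_absorb: "\<lbrakk>x \<in> carrier D; y \<in> carrier D\<rbrakk> \<Longrightarrow> x \<squnion> (x \<curlywedge> y) = x \<squnion> x"
    and opp_opp_join: "\<lbrakk>x \<in> carrier D; y \<in> carrier D\<rbrakk> \<Longrightarrow> \<lrcorner> (\<lrcorner> (x \<squnion> y)) = x \<squnion> y"
    and join_opp: "x \<in> carrier D \<Longrightarrow> x \<squnion> \<lrcorner> x = \<top>"
    and opp_top: "\<lrcorner> \<top> = \<bottom> \<squnion> \<bottom>"
    and opp_bot: "\<lrcorner> \<bottom> = \<top>"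
    and meet_join_self: "x \<in> carrier D \<Longrightarrow>
          (x \<sqinter> x) \<squnion> (x \<sqinter> x) = (x \<squnion> x) \<sqinter> (x \<squnion> x)"

definition dba_meet_part :: "('a, 'm) dba_scheme \<Rightarrow> 'a set"
  where "dba_meet_part D = {x \<in> carrier D. x \<sqinter>\<^bsub>D\<^esub> x = x}"

definition dba_join_part :: "('a, 'm) dba_scheme \<Rightarrow> 'a set"
  where "dba_join_part D = {x \<in> carrier D. x \<squnion>\<^bsub>D\<^esub> x = x}"

definition dba_pure :: "('a, 'm) dba_scheme \<Rightarrow> ('a, 'm) dba_scheme"
  where "dba_pure D = D\<lparr>carrier := dba_meet_part D \<union> dba_join_part D\<rparr>"

locale fully_contextual_dba = double_boolean_algebra +
  assumes le_partial_order:
      "partial_order_on (carrier D) {(x, y). x \<in> carrier D \<and> y \<in> carrier D \<and> x \<sqsubseteq> y}"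
    and contextual:
      "\<lbrakk>y \<in> dba_meet_part D; x \<in> dba_join_part D; y \<squnion> y = x \<sqinter> x\<rbrakk> \<Longrightarrow>
        \<exists>!z. z \<in> carrier D \<and> z \<sqinter> z = y \<and> z \<squnion> z = x"

definition dba_iso :: "('a, 'm) dba_scheme \<Rightarrow> ('b, 'n) dba_scheme \<Rightarrow> ('a \<Rightarrow> 'b) set"
  where "dba_iso D M = {h. bij_betw h (carrier D) (carrier M) \<and>
    (\<forall>x\<in>carrier D. \<forall>y\<in>carrier D. h (x \<squnion>\<^bsub>D\<^esub> y) = h x \<squnion>\<^bsub>M\<^esub> h y) \<and>
    (\<forall>x\<in>carrier D. \<forall>y\<in>carrier D. h (x \<sqinter>\<^bsub>D\<^esub> y) = h x \<sqinter>\<^bsub>M\<^esub> h y) \<and>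
    (\<forall>x\<in>carrier D. h (\<sim>\<^bsub>D\<^esub> x) = \<sim>\<^bsub>M\<^esub> (h x)) \<and>
    (\<forall>x\<in>carrier D. h (\<lrcorner>\<^bsub>D\<^esub> x) = \<lrcorner>\<^bsub>M\<^esub> (h x)) \<and>
    h \<top>\<^bsub>D\<^esub> = \<top>\<^bsub>M\<^esub> \<and> h \<bottom>\<^bsub>D\<^esub> = \<bottom>\<^bsub>M\<^esub>}"

definition dba_isomorphic :: "('a, 'm) dba_scheme \<Rightarrow> ('b, 'n) dba_scheme \<Rightarrow> bool"
  where "dba_isomorphic D M \<longleftrightarrow> dba_iso D M \<noteq> {}"

context double_boolean_algebra
begin

lemma meet_in_meet_part:
  assumes "x \<in> carrier D" "y \<in> carrier D"
  shows "x \<sqinter> y \<in> dba_meet_part D"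
proof -
  have "(x \<sqinter> y) \<sqinter> (x \<sqinter> y) = (x \<sqinter> x) \<sqinter> (y \<sqinter> y)"
    using assms by (metis meet_assoc meet_comm meet_closed)
  also have "\<dots> = x \<sqinter> y"
    using assms by (metis meet_idem_left meet_comm meet_closed)
  finally show ?thesis
    using assms by (simp add: dba_meet_part_def meet_closed)
qed

lemma join_in_join_part:
  assumes "x \<in> carrier D" "y \<in> carrier D"
  shows "x \<squnion> y \<in> dba_join_part D"
proof -
  have "(x \<squnion> y) \<squnion> (x \<squnion> y) = (x \<squnion> x) \<squnion> (y \<squnion> y)"
    using assms by (metis join_assoc join_comm join_closed)
  also have "\<dots> = x \<squnion> y"
    using assms by (metis join_idem_left join_comm join_closed)
  finally show ?thesis
    using assms by (simp add: dba_join_part_def join_closed)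
qed

lemma neg_in_meet_part:
  assumes "x \<in> carrier D"
  shows "\<sim> x \<in> dba_meet_part D"
  using assms by (metis meet_in_meet_part neg_closed neg_meet_self neg_neg_meet)

lemma opp_in_join_part:
  assumes "x \<in> carrier D"
  shows "\<lrcorner> x \<in> dba_join_part D"
  using assms by (metis join_in_join_part opp_closed opp_join_self opp_opp_join)

lemma dba_pure_subalgebra: "double_boolean_algebra (dba_pure D)"
proof -
  let ?P = "dba_meet_part D \<union> dba_join_part D"
  have sub: "x \<in> carrier D" if "x \<in> ?P" for x
    using that by (auto simp: dba_meet_part_def dba_join_part_def)
  have bot: "\<bottom> \<in> ?P"
    using neg_in_meet_part[OF top_closed] by (simp add: neg_top)
  have top: "\<top> \<in> ?P"
    using opp_in_join_part[OF bot_closed] by (simp add: opp_bot)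
  note [simp] = dba_pure_def dba_vee_def dba_wedge_def
  show ?thesis
    apply (unfold_locales; simp del: Un_iff)
    subgoal using sub join_in_join_part by blast
    subgoal using sub meet_in_meet_part by blast
    subgoal using sub neg_in_meet_part by blast
    subgoal using sub opp_in_join_part by blast
    subgoal by (rule top)
    subgoal by (rule bot)
    subgoal by (intro meet_idem_left sub)
    subgoal by (intro meet_comm sub)
    subgoal by (intro meet_assoc sub)
    subgoal by (intro neg_meet_self sub)
    subgoal by (intro meet_join_absorb sub)
    subgoal by (intro meet_vee_distrib[unfolded dba_vee_def] sub)
    subgoal by (intro meet_vee_absorb[unfolded dba_vee_def] sub)
    subgoal by (intro neg_neg_meet sub)
    subgoal by (intro meet_neg sub)
    subgoal by (rule neg_bot)
    subgoal by (rule neg_top)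
    subgoal by (intro join_idem_left sub)
    subgoal by (intro join_comm sub)
    subgoal by (intro join_assoc sub)
    subgoal by (intro opp_join_self sub)
    subgoal by (intro join_meet_absorb sub)
    subgoal by (intro join_wedge_distrib[unfolded dba_wedge_def] sub)
    subgoal by (intro join_wedge_absorb[unfolded dba_wedge_def] sub)
    subgoal by (intro opp_opp_join sub)
    subgoal by (intro join_opp sub)
    subgoal by (rule opp_top)
    subgoal by (rule opp_bot)
    subgoal by (intro meet_join_self sub)
    done
qed

end

end

theory Submission
  imports Defs
begin

text \<open>
  In a fully contextual algebra an element \<open>z\<close> is the same thing as a pair \<open>(a, b)\<close> with
  \<open>a\<close> in the meet part, \<open>b\<close> in the join part and \<open>a \<squnion> a = b \<sqinter> b\<close>, via
  \<open>a = z \<sqinter> z\<close>, \<open>b = z \<squnion> z\<close>. An isomorphism of the pure parts acts on such pairs, which gives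
  the only possible extension. It is a homomorphism because every operation takes values in the
  pure part and depends on its arguments only through \<open>z \<sqinter> z\<close> or \<open>z \<squnion> z\<close>.
\<close>

lemma carrier_dba_pure [simp]: "carrier (dba_pure D) = dba_meet_part D \<union> dba_join_part D"
  and dba_pure_ops [simp]:
    "x \<squnion>\<^bsub>dba_pure D\<^esub> y = x \<squnion>\<^bsub>D\<^esub> y" "x \<sqinter>\<^bsub>dba_pure D\<^esub> y = x \<sqinter>\<^bsub>D\<^esub> y"
    "\<sim>\<^bsub>dba_pure D\<^esub> x = \<sim>\<^bsub>D\<^esub> x" "\<lrcorner>\<^bsub>dba_pure D\<^esub> x = \<lrcorner>\<^bsub>D\<^esub> x"
    "\<top>\<^bsub>dba_pure D\<^esub> = \<top>\<^bsub>D\<^esub>" "\<bottom>\<^bsub>dba_pure D\<^esub> = \<bottom>\<^bsub>D\<^esub>"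
  by (simp_all add: dba_pure_def)

lemma meet_part_carrier: "x \<in> dba_meet_part D \<Longrightarrow> x \<in> carrier D"
  and join_part_carrier: "x \<in> dba_join_part D \<Longrightarrow> x \<in> carrier D"
  by (simp_all add: dba_meet_part_def dba_join_part_def)

text \<open>The elements with \<open>x \<sqinter> x = x\<close> or \<open>x \<squnion> x = x\<close>
  already lie in the pure carrier, so shrinking the carrier loses none of them. This lets facts
  about the parts of a general algebra be applied to \<open>dba_pure D\<close>.\<close>

lemma meet_part_dba_pure [simp]: "dba_meet_part (dba_pure D) = dba_meet_part D"
  and join_part_dba_pure [simp]: "dba_join_part (dba_pure D) = dba_join_part D"
  by (auto simp: dba_meet_part_def[of "dba_pure D"] dba_join_part_def[of "dba_pure D"])
    (auto simp: dba_meet_part_def dba_join_part_def)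

lemma dba_isoD:
  assumes "h \<in> dba_iso D M"
  shows "bij_betw h (carrier D) (carrier M)"
    and "\<lbrakk>x \<in> carrier D; y \<in> carrier D\<rbrakk> \<Longrightarrow> h (x \<squnion>\<^bsub>D\<^esub> y) = h x \<squnion>\<^bsub>M\<^esub> h y"
    and "\<lbrakk>x \<in> carrier D; y \<in> carrier D\<rbrakk> \<Longrightarrow> h (x \<sqinter>\<^bsub>D\<^esub> y) = h x \<sqinter>\<^bsub>M\<^esub> h y"
    and "x \<in> carrier D \<Longrightarrow> h (\<sim>\<^bsub>D\<^esub> x) = \<sim>\<^bsub>M\<^esub> (h x)"
    and "x \<in> carrier D \<Longrightarrow> h (\<lrcorner>\<^bsub>D\<^esub> x) = \<lrcorner>\<^bsub>M\<^esub> (h x)"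
    and "h \<top>\<^bsub>D\<^esub> = \<top>\<^bsub>M\<^esub>" and "h \<bottom>\<^bsub>D\<^esub> = \<bottom>\<^bsub>M\<^esub>"
  using assms by (auto simp: dba_iso_def)

context double_boolean_algebra
begin

text \<open>Serves, with its dual below, to replace arbitrary arguments by pure ones, on which an
  isomorphism of the pure parts is defined.\<close>

lemma meet_self_meet_self:
  "\<lbrakk>x \<in> carrier D; y \<in> carrier D\<rbrakk> \<Longrightarrow> (x \<sqinter> x) \<sqinter> (y \<sqinter> y) = x \<sqinter> y"
  by (metis meet_idem_left meet_comm meet_closed)

lemma join_self_join_self:
  "\<lbrakk>x \<in> carrier D; y \<in> carrier D\<rbrakk> \<Longrightarrow> (x \<squnion> x) \<squnion> (y \<squnion> y) = x \<squnion> y"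
  by (metis join_idem_left join_comm join_closed)

lemma top_in_join_part: "\<top> \<in> dba_join_part D"
  using opp_in_join_part[OF bot_closed] by (simp add: opp_bot)

lemma bot_in_meet_part: "\<bottom> \<in> dba_meet_part D"
  using neg_in_meet_part[OF top_closed] by (simp add: neg_top)

end

context fully_contextual_dba
begin

text \<open>The uniqueness half of \<open>contextual\<close>, taken at the pair
  \<open>y \<sqinter> y\<close>, \<open>y \<squnion> y\<close>; this pair is compatible by
  \<open>meet_join_self\<close>.\<close>

lemma eq_if_same_parts:
  assumes "x \<in> carrier D" "y \<in> carrier D" "x \<sqinter> x = y \<sqinter> y" "x \<squnion> x = y \<squnion> y"
  shows "x = y"
  using contextual[of "y \<sqinter> y" "y \<squnion> y"] assms
  by (metis join_in_join_part meet_in_meet_part meet_join_self)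

end

text \<open>The two parts are the fixed points of \<open>x \<sqinter> x\<close> and
  \<open>x \<squnion> x\<close>. A homomorphism preserves such equations, and injectivity reflects
  them.\<close>

lemma dba_iso_image_parts:
  assumes "double_boolean_algebra D" "h \<in> dba_iso D M"
  shows "h ` dba_meet_part D = dba_meet_part M" and "h ` dba_join_part D = dba_join_part M"
proof -
  interpret double_boolean_algebra D by fact
  have bij: "bij_betw h (carrier D) (carrier M)" using assms(2) by (rule dba_isoD)
  have inj: "h x = h y \<longleftrightarrow> x = y" if "x \<in> carrier D" "y \<in> carrier D" for x y
    using bij that by (auto simp: bij_betw_def inj_on_def)
  have M: "carrier M = h ` carrier D" using bij by (simp add: bij_betw_def)
  have meet: "h x \<sqinter>\<^bsub>M\<^esub> h x = h x \<longleftrightarrow> x \<sqinter>\<^bsub>D\<^esub> x = x" if "x \<in> carrier D" for x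
    using that dba_isoD(3)[OF assms(2) that that] inj meet_closed by metis
  have join: "h x \<squnion>\<^bsub>M\<^esub> h x = h x \<longleftrightarrow> x \<squnion>\<^bsub>D\<^esub> x = x" if "x \<in> carrier D" for x
    using that dba_isoD(2)[OF assms(2) that that] inj join_closed by metis
  show "h ` dba_meet_part D = dba_meet_part M"
    unfolding dba_meet_part_def M using meet by auto
  show "h ` dba_join_part D = dba_join_part M"
    unfolding dba_join_part_def M using join by auto
qed

lemma dba_iso_pure:
  assumes "double_boolean_algebra D" "h \<in> dba_iso D M"
  shows "h \<in> dba_iso (dba_pure D) (dba_pure M)"
proof -
  have "bij_betw h (carrier (dba_pure D)) (carrier (dba_pure M))"
    by (rule bij_betw_subset[OF dba_isoD(1)[OF assms(2)]])
      (auto simp: image_Un dba_iso_image_parts[OF assms] meet_part_carrier join_part_carrier)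
  then show ?thesis
    using assms(2) by (auto simp: dba_iso_def meet_part_carrier join_part_carrier)
qed

text \<open>\<open>x \<sqinter> x\<close> and \<open>x \<squnion> x\<close> are pure, so the values
  there fix both parts of \<open>g x\<close> and of \<open>h x\<close>; in \<open>M\<close> these
  parts determine the element.\<close>

lemma dba_iso_eq_if_eq_on_pure:
  assumes "double_boolean_algebra D" "fully_contextual_dba M"
    and g: "g \<in> dba_iso D M" and h: "h \<in> dba_iso D M"
    and eq: "\<And>x. x \<in> carrier (dba_pure D) \<Longrightarrow> g x = h x"
    and x: "x \<in> carrier D"
  shows "g x = h x"
proof -
  interpret D: double_boolean_algebra D by fact
  interpret M: fully_contextual_dba M by fact
  show ?thesis
  proof (rule M.eq_if_same_parts)
    show "g x \<in> carrier M" "h x \<in> carrier M"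
      using dba_isoD(1)[OF g] dba_isoD(1)[OF h] x by (auto simp: bij_betw_def)
    show "g x \<sqinter>\<^bsub>M\<^esub> g x = h x \<sqinter>\<^bsub>M\<^esub> h x"
      using eq[of "x \<sqinter>\<^bsub>D\<^esub> x"] D.meet_in_meet_part[OF x x]
        dba_isoD(3)[OF g x x] dba_isoD(3)[OF h x x] by simp
    show "g x \<squnion>\<^bsub>M\<^esub> g x = h x \<squnion>\<^bsub>M\<^esub> h x"
      using eq[of "x \<squnion>\<^bsub>D\<^esub> x"] D.join_in_join_part[OF x x]
        dba_isoD(2)[OF g x x] dba_isoD(2)[OF h x x] by simp
  qed
qed

text \<open>Existence of the extension. It is made \<open>extensional\<close> so that uniqueness can
  later be stated as equality of total functions.\<close>

lemma dba_iso_pure_extends: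
  assumes "fully_contextual_dba D" "fully_contextual_dba M"
    and f: "f \<in> dba_iso (dba_pure D) (dba_pure M)"
  obtains g where "g \<in> dba_iso D M" "g \<in> extensional (carrier D)"
    "\<And>x. x \<in> carrier (dba_pure D) \<Longrightarrow> g x = f x"
proof -
  interpret D: fully_contextual_dba D by fact
  interpret M: fully_contextual_dba M by fact
  let ?P = "dba_meet_part D \<union> dba_join_part D"
  have f_bij: "bij_betw f ?P (dba_meet_part M \<union> dba_join_part M)"
    using dba_isoD(1)[OF f] by simp
  have f_inj: "f x = f y \<longleftrightarrow> x = y" if "x \<in> ?P" "y \<in> ?P" for x y
    using inj_on_eq_iff[OF bij_betw_imp_inj_on[OF f_bij] that] .
  have f_join: "f (x \<squnion>\<^bsub>D\<^esub> y) = f x \<squnion>\<^bsub>M\<^esub> f y" if "x \<in> ?P" "y \<in> ?P" for x y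
    using dba_isoD(2)[OF f] that by simp
  have f_meet: "f (x \<sqinter>\<^bsub>D\<^esub> y) = f x \<sqinter>\<^bsub>M\<^esub> f y" if "x \<in> ?P" "y \<in> ?P" for x y
    using dba_isoD(3)[OF f] that by simp
  have f_neg: "f (\<sim>\<^bsub>D\<^esub> x) = \<sim>\<^bsub>M\<^esub> (f x)" if "x \<in> ?P" for x
    using dba_isoD(4)[OF f] that by simp
  have f_opp: "f (\<lrcorner>\<^bsub>D\<^esub> x) = \<lrcorner>\<^bsub>M\<^esub> (f x)" if "x \<in> ?P" for x
    using dba_isoD(5)[OF f] that by simp
  have parts: "f ` dba_meet_part D = dba_meet_part M" "f ` dba_join_part D = dba_join_part M"
    using dba_iso_image_parts[OF D.dba_pure_subalgebra f] by simp_all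
  have meetP: "x \<sqinter>\<^bsub>D\<^esub> y \<in> ?P" and joinP: "x \<squnion>\<^bsub>D\<^esub> y \<in> ?P"
    if "x \<in> carrier D" "y \<in> carrier D" for x y
    using that D.meet_in_meet_part D.join_in_join_part by blast+
  have negP: "\<sim>\<^bsub>D\<^esub> x \<in> ?P" and oppP: "\<lrcorner>\<^bsub>D\<^esub> x \<in> ?P" if "x \<in> carrier D" for x
    using that D.neg_in_meet_part D.opp_in_join_part by blast+
  have P_carrier: "x \<in> carrier D" and fP_carrier: "f x \<in> carrier M" if "x \<in> ?P" for x
    using that parts by (auto dest: meet_part_carrier join_part_carrier)

  \<comment> \<open>\<open>g z\<close> is the element of \<open>M\<close> whose pair of parts is the
    image under \<open>f\<close> of the pair of \<open>z\<close>; outside the carrier the value is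
    \<open>undefined\<close>.\<close>
  define g where "g = (\<lambda>z\<in>carrier D. THE w. w \<in> carrier M \<and>
    w \<sqinter>\<^bsub>M\<^esub> w = f (z \<sqinter>\<^bsub>D\<^esub> z) \<and> w \<squnion>\<^bsub>M\<^esub> w = f (z \<squnion>\<^bsub>D\<^esub> z))"
  have g: "g z \<in> carrier M \<and> g z \<sqinter>\<^bsub>M\<^esub> g z = f (z \<sqinter>\<^bsub>D\<^esub> z) \<and> g z \<squnion>\<^bsub>M\<^esub> g z = f (z \<squnion>\<^bsub>D\<^esub> z)"
    if z: "z \<in> carrier D" for z
  proof -
    \<comment> \<open>Compatibility of the image pair is the image under \<open>f\<close> of
      \<open>meet_join_self\<close> in \<open>D\<close>; every term involved is pure.\<close>
    have "f (z \<sqinter>\<^bsub>D\<^esub> z) \<squnion>\<^bsub>M\<^esub> f (z \<sqinter>\<^bsub>D\<^esub> z) = f (z \<squnion>\<^bsub>D\<^esub> z) \<sqinter>\<^bsub>M\<^esub> f (z \<squnion>\<^bsub>D\<^esub> z)"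
      using f_join[OF meetP meetP, OF z z z z] f_meet[OF joinP joinP, OF z z z z]
        D.meet_join_self[OF z] by simp
    then have "\<exists>!w. w \<in> carrier M \<and> w \<sqinter>\<^bsub>M\<^esub> w = f (z \<sqinter>\<^bsub>D\<^esub> z) \<and> w \<squnion>\<^bsub>M\<^esub> w = f (z \<squnion>\<^bsub>D\<^esub> z)"
      using D.meet_in_meet_part[OF z z] D.join_in_join_part[OF z z]
      by (intro M.contextual) (simp_all flip: parts)
    from theI'[OF this] show ?thesis using z by (simp add: g_def)
  qed
  have g_eqI: "g z = w" if "z \<in> carrier D" "w \<in> carrier M"
    "w \<sqinter>\<^bsub>M\<^esub> w = f (z \<sqinter>\<^bsub>D\<^esub> z)" "w \<squnion>\<^bsub>M\<^esub> w = f (z \<squnion>\<^bsub>D\<^esub> z)" for z w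
    by (rule M.eq_if_same_parts) (use g[OF that(1)] that in auto)
  \<comment> \<open>For pure \<open>x\<close> the element \<open>f x\<close> itself has the required
    parts, because \<open>f\<close> commutes with squaring.\<close>
  have g_f: "g x = f x" if "x \<in> ?P" for x
    using that by (intro g_eqI) (simp_all only: P_carrier fP_carrier f_meet f_join)

  have "inj_on g (carrier D)"
  proof (rule inj_onI)
    fix x y assume x: "x \<in> carrier D" and y: "y \<in> carrier D" and eq: "g x = g y"
    have "f (x \<sqinter>\<^bsub>D\<^esub> x) = f (y \<sqinter>\<^bsub>D\<^esub> y)" "f (x \<squnion>\<^bsub>D\<^esub> x) = f (y \<squnion>\<^bsub>D\<^esub> y)"
      using g[OF x] g[OF y] eq by auto
    then show "x = y"
      using f_inj[OF meetP meetP, OF x x y y] f_inj[OF joinP joinP, OF x x y y]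
        D.eq_if_same_parts[OF x y] by simp
  qed
  moreover have "w \<in> g ` carrier D" if w: "w \<in> carrier M" for w
  proof -
    \<comment> \<open>Surjectivity: pull the pair of \<open>w\<close> back along \<open>f\<close>.
      Since \<open>f\<close> maps each part onto the corresponding part, \<open>a\<close> and
      \<open>b\<close> can be chosen in the right parts of \<open>D\<close>.\<close>
    obtain a where a: "a \<in> dba_meet_part D" "f a = w \<sqinter>\<^bsub>M\<^esub> w"
      using M.meet_in_meet_part[OF w w] parts(1) by force
    obtain b where b: "b \<in> dba_join_part D" "f b = w \<squnion>\<^bsub>M\<^esub> w"
      using M.join_in_join_part[OF w w] parts(2) by force
    have "f (a \<squnion>\<^bsub>D\<^esub> a) = f (b \<sqinter>\<^bsub>D\<^esub> b)"
      using a b f_join[of a a] f_meet[of b b] M.meet_join_self[OF w] by simp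
    \<comment> \<open>Injectivity of \<open>f\<close> brings compatibility back to \<open>D\<close>,
      so \<open>contextual\<close> supplies an element with parts \<open>a\<close> and
      \<open>b\<close>.\<close>
    then have "a \<squnion>\<^bsub>D\<^esub> a = b \<sqinter>\<^bsub>D\<^esub> b"
      using f_inj[OF joinP meetP] meet_part_carrier[OF a(1)] join_part_carrier[OF b(1)] by simp
    then obtain z where "z \<in> carrier D" "z \<sqinter>\<^bsub>D\<^esub> z = a" "z \<squnion>\<^bsub>D\<^esub> z = b"
      using D.contextual[OF a(1) b(1)] by blast
    then show ?thesis using g_eqI[of z w] w a(2) b(2) by auto
  qed
  ultimately have "bij_betw g (carrier D) (carrier M)"
    using g by (auto simp: bij_betw_def)
  \<comment> \<open>\<open>x \<squnion> y\<close> is pure, so \<open>g\<close> agrees with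
    \<open>f\<close> there. Writing it as the join of \<open>x \<squnion> x\<close> and
    \<open>y \<squnion> y\<close> makes \<open>f_join\<close> applicable. The meet case is dual, and
    the two complements are treated likewise.\<close>
  moreover have "g (x \<squnion>\<^bsub>D\<^esub> y) = g x \<squnion>\<^bsub>M\<^esub> g y" if "x \<in> carrier D" "y \<in> carrier D" for x y
    using that g_f[OF joinP] f_join[OF joinP joinP, of x x y y] g[of x] g[of y]
      D.join_self_join_self[of x y] M.join_self_join_self[of "g x" "g y"] by simp
  moreover have "g (x \<sqinter>\<^bsub>D\<^esub> y) = g x \<sqinter>\<^bsub>M\<^esub> g y" if "x \<in> carrier D" "y \<in> carrier D" for x y
    using that g_f[OF meetP] f_meet[OF meetP meetP, of x x y y] g[of x] g[of y]
      D.meet_self_meet_self[of x y] M.meet_self_meet_self[of "g x" "g y"] by simp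
  moreover have "g (\<sim>\<^bsub>D\<^esub> x) = \<sim>\<^bsub>M\<^esub> (g x)" if "x \<in> carrier D" for x
    using that g_f[OF negP] f_neg[OF meetP, of x x] g[of x]
      D.neg_meet_self[of x] M.neg_meet_self[of "g x"] by simp
  moreover have "g (\<lrcorner>\<^bsub>D\<^esub> x) = \<lrcorner>\<^bsub>M\<^esub> (g x)" if "x \<in> carrier D" for x
    using that g_f[OF oppP] f_opp[OF joinP, of x x] g[of x]
      D.opp_join_self[of x] M.opp_join_self[of "g x"] by simp
  moreover have "g \<top>\<^bsub>D\<^esub> = \<top>\<^bsub>M\<^esub>" "g \<bottom>\<^bsub>D\<^esub> = \<bottom>\<^bsub>M\<^esub>"
    using g_f dba_isoD(6,7)[OF f] D.top_in_join_part D.bot_in_meet_part by simp_all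
  ultimately have "g \<in> dba_iso D M" by (simp add: dba_iso_def)
  moreover have "g \<in> extensional (carrier D)" by (simp add: g_def)
  ultimately show thesis using that g_f by simp
qed

theorem mainTheorem13:
  fixes D :: "('a, 'm) dba_scheme" and M :: "('b, 'n) dba_scheme"
  assumes "fully_contextual_dba D" and "fully_contextual_dba M"
  shows "(dba_isomorphic D M \<longleftrightarrow> dba_isomorphic (dba_pure D) (dba_pure M)) \<and>
    (\<forall>f \<in> dba_iso (dba_pure D) (dba_pure M).
      \<exists>!g. g \<in> dba_iso D M \<and> g \<in> extensional (carrier D) \<and>
        (\<forall>x \<in> carrier (dba_pure D). g x = f x))"
proof (intro conjI ballI)
  have D: "double_boolean_algebra D"
    using assms(1) by (rule fully_contextual_dba.axioms)
  \<comment> \<open>Forwards an isomorphism is restricted to the pure parts; backwards it is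
    extended.\<close>
  show "dba_isomorphic D M \<longleftrightarrow> dba_isomorphic (dba_pure D) (dba_pure M)"
    unfolding dba_isomorphic_def
    by (metis dba_iso_pure[OF D] dba_iso_pure_extends[OF assms] ex_in_conv)
  fix f assume "f \<in> dba_iso (dba_pure D) (dba_pure M)"
  then obtain g where g: "g \<in> dba_iso D M" "g \<in> extensional (carrier D)"
    "\<And>x. x \<in> carrier (dba_pure D) \<Longrightarrow> g x = f x"
    by (rule dba_iso_pure_extends[OF assms]) blast
  show "\<exists>!g. g \<in> dba_iso D M \<and> g \<in> extensional (carrier D) \<and>
    (\<forall>x \<in> carrier (dba_pure D). g x = f x)"
  proof (rule ex1I[of _ g], use g in blast)
    fix h assume h: "h \<in> dba_iso D M \<and> h \<in> extensional (carrier D) \<and>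
      (\<forall>x \<in> carrier (dba_pure D). h x = f x)"
    show "h = g"
    \<comment> \<open>On the carrier both maps are determined by \<open>f\<close>; elsewhere both
      are \<open>undefined\<close>.\<close>
    proof (rule extensionalityI[of _ "carrier D"])
      fix x assume "x \<in> carrier D"
      then show "h x = g x"
        by (rule dba_iso_eq_if_eq_on_pure[OF D assms(2), rotated -1]) (use h g in auto)
    qed (use h g in auto)
  qed
qed

end
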